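(* Let $G$ and $H$ be Beauville groups of coprime order such that $G$ is a purely non-strongly real Beauville group. Then $G\times H$ is a purely non-strongly real Beauville group.
   Context: Conjugation convention: $g^h=hgh^{-1}$. For a finite group $G$ with identity $e$ and $x,y\in G$, let \[ \Sigma(x,y):=\bigcup_{i=1}^{|G|}\bigcup_{g\in G}\{(x^i)^g,(y^i)^g,((xy)^i)^g\}. \] A Beauville structure for a finite group $G$ is a set of pairs $\{(x_1,y_1),(x_2,y_2)\}\subset G\times G$ such that $\langle x_1,y_1\rangle=\langle x_2,y_2\rangle=G$ and $\Sigma(x_1,y_1)\cap\Sigma(x_2,y_2)=\{e\}$. A finite group $G$ is a Beauville group if it has a Beauville structure. A Beauville structure $\{(x_1,y_1),(x_2,y_2)\}$ of $G$ is strongly real if there exist an automorphism $\phi\in\mathrm{Aut}(G)$ and elements $g_1,g_2\in G$ such that $g_i\phi(x_i)g_i^{-1}=x_i^{-1}$ and $g_i\phi(y_i)g_i^{-1}=y_i^{-1}$ for $i=1,2$. A finite group $G$ is a purely non-strongly real Beauville group if $G$ is a Beauville group and none of its Beauville structures is strongly real. *)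

theory Defs
  imports "HOL-Algebra.Bij" "HOL-Algebra.Generated_Groups"
begin

text \<open>The set \<open>\<Sigma>(x, y)\<close>, with the convention that the conjugate of \<open>a\<close> by \<open>g\<close> is \<open>g a g\<^sup>-\<^sup>1\<close>.\<close>

definition beauville_Sigma :: "('a, 'm) monoid_scheme \<Rightarrow> 'a \<Rightarrow> 'a \<Rightarrow> 'a set" where
  "beauville_Sigma G x y =
    (\<Union>i\<in>{1..order G}. \<Union>g\<in>carrier G.
      {g \<otimes>\<^bsub>G\<^esub> (x [^]\<^bsub>G\<^esub> i) \<otimes>\<^bsub>G\<^esub> inv\<^bsub>G\<^esub> g,
       g \<otimes>\<^bsub>G\<^esub> (y [^]\<^bsub>G\<^esub> i) \<otimes>\<^bsub>G\<^esub> inv\<^bsub>G\<^esub> g,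
       g \<otimes>\<^bsub>G\<^esub> ((x \<otimes>\<^bsub>G\<^esub> y) [^]\<^bsub>G\<^esub> i) \<otimes>\<^bsub>G\<^esub> inv\<^bsub>G\<^esub> g})"

text \<open>
  Beauville structures are unordered: \<open>S\<close> is the set \<open>{(x\<^sub>1, y\<^sub>1), (x\<^sub>2, y\<^sub>2)}\<close>. The two pairs are not
  required to be distinct; they can coincide only in the trivial group.
\<close>

definition beauville_structure :: "('a, 'm) monoid_scheme \<Rightarrow> ('a \<times> 'a) set \<Rightarrow> bool" where
  "beauville_structure G S \<longleftrightarrow>
    (\<exists>x1\<in>carrier G. \<exists>y1\<in>carrier G. \<exists>x2\<in>carrier G. \<exists>y2\<in>carrier G.
      S = {(x1, y1), (x2, y2)} \<and>
      generate G {x1, y1} = carrier G \<and>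
      generate G {x2, y2} = carrier G \<and>
      beauville_Sigma G x1 y1 \<inter> beauville_Sigma G x2 y2 = {\<one>\<^bsub>G\<^esub>})"

definition beauville_group :: "('a, 'm) monoid_scheme \<Rightarrow> bool" where
  "beauville_group G \<longleftrightarrow> group G \<and> finite (carrier G) \<and> (\<exists>S. beauville_structure G S)"

text \<open>Only meaningful when \<open>S\<close> is a Beauville structure of \<open>G\<close>.\<close>

definition strongly_real :: "('a, 'm) monoid_scheme \<Rightarrow> ('a \<times> 'a) set \<Rightarrow> bool" where
  "strongly_real G S \<longleftrightarrow>
    (\<exists>x1 y1 x2 y2. S = {(x1, y1), (x2, y2)} \<and>
      (\<exists>\<phi>\<in>auto G. \<exists>g1\<in>carrier G. \<exists>g2\<in>carrier G.
        g1 \<otimes>\<^bsub>G\<^esub> \<phi> x1 \<otimes>\<^bsub>G\<^esub> inv\<^bsub>G\<^esub> g1 = inv\<^bsub>G\<^esub> x1 \<and>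
        g1 \<otimes>\<^bsub>G\<^esub> \<phi> y1 \<otimes>\<^bsub>G\<^esub> inv\<^bsub>G\<^esub> g1 = inv\<^bsub>G\<^esub> y1 \<and>
        g2 \<otimes>\<^bsub>G\<^esub> \<phi> x2 \<otimes>\<^bsub>G\<^esub> inv\<^bsub>G\<^esub> g2 = inv\<^bsub>G\<^esub> x2 \<and>
        g2 \<otimes>\<^bsub>G\<^esub> \<phi> y2 \<otimes>\<^bsub>G\<^esub> inv\<^bsub>G\<^esub> g2 = inv\<^bsub>G\<^esub> y2))"

definition purely_non_strongly_real :: "('a, 'm) monoid_scheme \<Rightarrow> bool" where
  "purely_non_strongly_real G \<longleftrightarrow>
    beauville_group G \<and> (\<forall>S. beauville_structure G S \<longrightarrow> \<not> strongly_real G S)"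

end

theory Submission
  imports Defs "HOL-Algebra.Multiplicative_Group" "HOL-Number_Theory.Cong"
begin

text \<open>
  If \<open>j \<equiv> 1\<close> modulo \<open>|G|\<close> and \<open>j \<equiv> 0\<close> modulo \<open>|H|\<close>, then \<open>(a, b)\<^sup>j = (a, 1)\<close>. Hence pairs generate
  \<open>G \<times> H\<close> as soon as their components generate the factors, and \<open>\<Sigma>\<close> of the first components embeds
  into \<open>\<Sigma>\<close> in \<open>G \<times> H\<close>; so Beauville structures of the factors combine, and Beauville structures of
  \<open>G \<times> H\<close> project to \<open>G\<close>. Both factors are moreover characteristic, so an automorphism realising
  strong reality of a structure of \<open>G \<times> H\<close> restricts to one for its projection to \<open>G\<close>.
\<close>

section \<open>Powers and the set \<Sigma> in a single group\<close>

lemma (in group) pow_cong_order: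
  assumes "x \<in> carrier G" "[i = j] (mod order G)"
  shows "x [^] i = x [^] (j::nat)"
proof -
  have red: "x [^] k = x [^] (k mod order G)" for k :: nat
  proof -
    have "x [^] k = x [^] (order G * (k div order G) + k mod order G)" by simp
    also have "\<dots> = (x [^] order G) [^] (k div order G) \<otimes> x [^] (k mod order G)"
      using assms(1) by (simp only: nat_pow_mult nat_pow_pow)
    also have "\<dots> = x [^] (k mod order G)" using assms(1) by (simp add: pow_order_eq_1)
    finally show ?thesis .
  qed
  show ?thesis using red [of i] red [of j] assms(2) by (simp add: cong_def)
qed

text \<open>Powers depend only on the exponent modulo \<open>order G\<close>, and
  \<open>{1..order G}\<close> meets every residue class. Dropping the bound spares comparing
  exponent ranges between a factor and the product.\<close>

lemma (in group) beauville_Sigma_iff: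
  assumes "finite (carrier G)" "x \<in> carrier G" "y \<in> carrier G"
  shows "a \<in> beauville_Sigma G x y \<longleftrightarrow>
    (\<exists>i::nat. \<exists>g\<in>carrier G. \<exists>z\<in>{x, y, x \<otimes> y}. a = g \<otimes> (z [^] i) \<otimes> inv g)"
    (is "_ \<longleftrightarrow> ?R")
proof
  assume "a \<in> beauville_Sigma G x y"
  then show ?R unfolding beauville_Sigma_def by blast
next
  assume ?R
  then obtain i g z where w: "g \<in> carrier G" "z \<in> {x, y, x \<otimes> y}" "a = g \<otimes> (z [^] (i::nat)) \<otimes> inv g"
    by blast
  \<comment> \<open>Residue 0 is represented by \<open>order G\<close>, because the exponents in the
    definition of \<Sigma> start at 1.\<close>
  define j where "j = (if i mod order G = 0 then order G else i mod order G)"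
  have pos: "order G > 0" using assms(1) by (simp add: order_gt_0_iff_finite)
  have "j \<in> {1..order G}" unfolding j_def using pos by (auto simp: less_imp_le)
  moreover have "[i = j] (mod order G)" unfolding j_def by (auto simp: cong_def)
  then have "z [^] i = z [^] j" using w(2) assms(2,3) by (intro pow_cong_order) auto
  with w have "a \<in> {g \<otimes> (x [^] j) \<otimes> inv g, g \<otimes> (y [^] j) \<otimes> inv g, g \<otimes> ((x \<otimes> y) [^] j) \<otimes> inv g}"
    by auto
  ultimately show "a \<in> beauville_Sigma G x y"
    unfolding beauville_Sigma_def using w(1) by blast
qed

text \<open>Reduces the requirement that two such sets meet exactly in the identity to an
  inclusion.\<close>

lemma (in group) one_in_beauville_Sigma:
  assumes "finite (carrier G)" "x \<in> carrier G" "y \<in> carrier G"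
  shows "\<one> \<in> beauville_Sigma G x y"
  unfolding beauville_Sigma_iff [OF assms]
  by (rule exI [of _ 0], rule bexI [of _ \<one>]) auto

text \<open>The representation of a structure as a doubleton is unique up to swapping the two pairs.\<close>

lemma beauville_structure_doubleton_iff:
  "beauville_structure G {(x1, y1), (x2, y2)} \<longleftrightarrow>
    {x1, y1, x2, y2} \<subseteq> carrier G \<and>
    generate G {x1, y1} = carrier G \<and> generate G {x2, y2} = carrier G \<and>
    beauville_Sigma G x1 y1 \<inter> beauville_Sigma G x2 y2 = {\<one>\<^bsub>G\<^esub>}"
  unfolding beauville_structure_def by (auto simp: doubleton_eq_iff Int_commute)

lemma nat_pow_DirProd:
  "(a, b) [^]\<^bsub>G \<times>\<times> H\<^esub> (i::nat) = (a [^]\<^bsub>G\<^esub> i, b [^]\<^bsub>H\<^esub> i)"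
  by (induction i) (simp_all add: nat_pow_def DirProd_def)

section \<open>Exponents and homomorphisms for groups of coprime order\<close>

locale coprime_groups = G: group G + H: group H for G (structure) and H (structure) +
  assumes finG: "finite (carrier G)" and finH: "finite (carrier H)"
    and cop: "coprime (order G) (order H)"
begin

sublocale P: group "G \<times>\<times> H"
  by (rule DirProd_group) (rule G.is_group, rule H.is_group)

lemma finP: "finite (carrier (G \<times>\<times> H))"
  by (simp add: DirProd_def finG finH)

text \<open>Results about the first factor pass to the second by interpreting the locale with the
  roles exchanged.\<close>

lemma swapped: "coprime_groups H G"
  using finG finH cop by unfold_locales (auto simp: coprime_commute)

text \<open>The Chinese remainder theorem gives \<open>j\<close> congruent to \<open>i\<close>
  modulo \<open>order G\<close> and to 0 modulo \<open>order H\<close>. The case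
  \<open>i = 1\<close> serves for generation, arbitrary \<open>i\<close> for the powers occurring in
  \<Sigma>.\<close>

lemma pow_fst_proj:
  fixes i :: nat
  shows "\<exists>j::nat. \<forall>a\<in>carrier G. \<forall>b\<in>carrier H. (a, b) [^]\<^bsub>G \<times>\<times> H\<^esub> j = (a [^]\<^bsub>G\<^esub> i, \<one>\<^bsub>H\<^esub>)"
proof -
  obtain j where j: "[j = i] (mod order G)" "[j = 0] (mod order H)"
    using binary_chinese_remainder_nat [OF cop] by blast
  have "(a, b) [^]\<^bsub>G \<times>\<times> H\<^esub> j = (a [^]\<^bsub>G\<^esub> i, \<one>\<^bsub>H\<^esub>)" if "a \<in> carrier G" "b \<in> carrier H" for a b
    using G.pow_cong_order [OF that(1) j(1)] H.pow_cong_order [OF that(2) j(2)]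
    by (simp add: nat_pow_DirProd)
  then show ?thesis by blast
qed

text \<open>The order of \<open>f a\<close> divides both group orders, hence is 1. This makes the
  components of an automorphism of the product that mix the two factors vanish.\<close>

lemma hom_eq_one:
  assumes "f \<in> hom G H" "a \<in> carrier G"
  shows "f a = \<one>\<^bsub>H\<^esub>"
proof -
  interpret f: group_hom G H f
    using assms(1) by unfold_locales
  have fa: "f a \<in> carrier H" using assms(2) by simp
  have "f a [^]\<^bsub>H\<^esub> order G = \<one>\<^bsub>H\<^esub>"
    using assms(2) by (simp add: f.hom_nat_pow [symmetric] G.pow_order_eq_1)
  then have "H.ord (f a) dvd order G" using fa by (simp add: H.pow_eq_id)
  moreover have "H.ord (f a) dvd order H" using fa by (rule H.ord_dvd_group_order)
  ultimately have "H.ord (f a) = 1"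
    using cop coprime_common_divisor_nat by blast
  then show ?thesis using fa H.ord_eq_1 by blast
qed

lemma fst_hom: "fst \<in> hom (G \<times>\<times> H) G"
  by (auto simp: hom_def DirProd_def)

lemma snd_hom: "snd \<in> hom (G \<times>\<times> H) H"
  by (auto simp: hom_def DirProd_def)

lemma inl_hom: "(\<lambda>a. (a, \<one>\<^bsub>H\<^esub>)) \<in> hom G (G \<times>\<times> H)"
  by (auto simp: hom_def DirProd_def)

lemma inr_hom: "(\<lambda>b. (\<one>\<^bsub>G\<^esub>, b)) \<in> hom H (G \<times>\<times> H)"
  by (auto simp: hom_def DirProd_def)

section \<open>The set \<Sigma> of a direct product\<close>

text \<open>Powers and conjugates are formed coordinatewise, with the same exponent and the same
  choice among the three elements in both coordinates.\<close>

lemma mem_beauville_Sigma_DirProdD: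
  assumes xy: "x \<in> carrier G" "y \<in> carrier G" "u \<in> carrier H" "v \<in> carrier H"
    and ab: "(a, b) \<in> beauville_Sigma (G \<times>\<times> H) (x, u) (y, v)"
  shows "a \<in> beauville_Sigma G x y" "b \<in> beauville_Sigma H u v"
proof -
  have "(x, u) \<in> carrier (G \<times>\<times> H)" "(y, v) \<in> carrier (G \<times>\<times> H)" using xy by simp_all
  from ab [unfolded P.beauville_Sigma_iff [OF finP this]]
  obtain i k p where "k \<in> carrier (G \<times>\<times> H)" "p \<in> {(x, u), (y, v), (x, u) \<otimes>\<^bsub>G \<times>\<times> H\<^esub> (y, v)}"
    "(a, b) = k \<otimes>\<^bsub>G \<times>\<times> H\<^esub> (p [^]\<^bsub>G \<times>\<times> H\<^esub> (i::nat)) \<otimes>\<^bsub>G \<times>\<times> H\<^esub> inv\<^bsub>G \<times>\<times> H\<^esub> k"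
    by blast
  moreover obtain g h z w where "k = (g, h)" "p = (z, w)" by (metis surj_pair)
  ultimately have *: "g \<in> carrier G" "h \<in> carrier H"
    "(z, w) \<in> {(x, u), (y, v), (x \<otimes>\<^bsub>G\<^esub> y, u \<otimes>\<^bsub>H\<^esub> v)}"
    "(a, b) = (g, h) \<otimes>\<^bsub>G \<times>\<times> H\<^esub> ((z, w) [^]\<^bsub>G \<times>\<times> H\<^esub> (i::nat)) \<otimes>\<^bsub>G \<times>\<times> H\<^esub> inv\<^bsub>G \<times>\<times> H\<^esub> (g, h)"
    by simp_all
  from *(1,2,4) have "a = g \<otimes>\<^bsub>G\<^esub> (z [^]\<^bsub>G\<^esub> i) \<otimes>\<^bsub>G\<^esub> inv\<^bsub>G\<^esub> g" "b = h \<otimes>\<^bsub>H\<^esub> (w [^]\<^bsub>H\<^esub> i) \<otimes>\<^bsub>H\<^esub> inv\<^bsub>H\<^esub> h"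
    by (simp_all add: nat_pow_DirProd G.is_group H.is_group)
  with *(1-3) show "a \<in> beauville_Sigma G x y" "b \<in> beauville_Sigma H u v"
    unfolding G.beauville_Sigma_iff [OF finG xy(1,2)] H.beauville_Sigma_iff [OF finH xy(3,4)]
    by blast+
qed

lemma mem_beauville_Sigma_DirProdI:
  assumes xy: "x \<in> carrier G" "y \<in> carrier G" "u \<in> carrier H" "v \<in> carrier H"
    and a: "a \<in> beauville_Sigma G x y"
  shows "(a, \<one>\<^bsub>H\<^esub>) \<in> beauville_Sigma (G \<times>\<times> H) (x, u) (y, v)"
proof -
  have P: "(x, u) \<in> carrier (G \<times>\<times> H)" "(y, v) \<in> carrier (G \<times>\<times> H)" using xy by simp_all
  from a obtain i g z where *: "g \<in> carrier G" "z \<in> {x, y, x \<otimes>\<^bsub>G\<^esub> y}"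
    "a = g \<otimes>\<^bsub>G\<^esub> (z [^]\<^bsub>G\<^esub> (i::nat)) \<otimes>\<^bsub>G\<^esub> inv\<^bsub>G\<^esub> g"
    unfolding G.beauville_Sigma_iff [OF finG xy(1,2)] by blast
  \<comment> \<open>\<open>w\<close> is the element of \<open>H\<close> paired with \<open>z\<close>
    in the triple; its value does not matter, since its \<open>j\<close>-th power will be the
    identity.\<close>
  from *(2) obtain w where w: "(z, w) \<in> {(x, u), (y, v), (x \<otimes>\<^bsub>G\<^esub> y, u \<otimes>\<^bsub>H\<^esub> v)}" by blast
  obtain j :: nat where "\<And>a b. a \<in> carrier G \<Longrightarrow> b \<in> carrier H \<Longrightarrow>
      (a, b) [^]\<^bsub>G \<times>\<times> H\<^esub> j = (a [^]\<^bsub>G\<^esub> i, \<one>\<^bsub>H\<^esub>)"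
    using pow_fst_proj [of i] by blast
  then have "(z, w) [^]\<^bsub>G \<times>\<times> H\<^esub> j = (z [^]\<^bsub>G\<^esub> i, \<one>\<^bsub>H\<^esub>)" using w xy by auto
  then have "(a, \<one>\<^bsub>H\<^esub>) = (g, \<one>\<^bsub>H\<^esub>) \<otimes>\<^bsub>G \<times>\<times> H\<^esub> ((z, w) [^]\<^bsub>G \<times>\<times> H\<^esub> j) \<otimes>\<^bsub>G \<times>\<times> H\<^esub> inv\<^bsub>G \<times>\<times> H\<^esub> (g, \<one>\<^bsub>H\<^esub>)"
    using *(1,3) by (simp add: G.is_group H.is_group)
  moreover have "(g, \<one>\<^bsub>H\<^esub>) \<in> carrier (G \<times>\<times> H)" using *(1) by simp
  ultimately show ?thesis
    unfolding P.beauville_Sigma_iff [OF finP P] using w by force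
qed

section \<open>Generation of a direct product\<close>

lemma fst_generate:
  assumes "A \<subseteq> carrier (G \<times>\<times> H)" "generate (G \<times>\<times> H) A = carrier (G \<times>\<times> H)"
  shows "generate G (fst ` A) = carrier G"
proof -
  interpret f: group_hom "G \<times>\<times> H" G fst
    using fst_hom by unfold_locales
  have "generate G (fst ` A) = fst ` carrier (G \<times>\<times> H)"
    using f.generate_img [OF assms(1)] assms(2) by simp
  also have "\<dots> = carrier G" using H.one_closed by (force simp: DirProd_def)
  finally show ?thesis .
qed

lemma fst_proj_in_generate:
  assumes "A \<subseteq> carrier (G \<times>\<times> H)" "a \<in> generate G (fst ` A)"
  shows "(a, \<one>\<^bsub>H\<^esub>) \<in> generate (G \<times>\<times> H) A"
proof -
  have sub: "subgroup (generate (G \<times>\<times> H) A) (G \<times>\<times> H)"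
    using assms(1) by (rule P.generate_is_subgroup)
  obtain j :: nat where j: "\<And>a b. a \<in> carrier G \<Longrightarrow> b \<in> carrier H \<Longrightarrow>
      (a, b) [^]\<^bsub>G \<times>\<times> H\<^esub> j = (a [^]\<^bsub>G\<^esub> (1::nat), \<one>\<^bsub>H\<^esub>)"
    using pow_fst_proj [of 1] by blast
  have "(fst p, \<one>\<^bsub>H\<^esub>) \<in> generate (G \<times>\<times> H) A" if "p \<in> A" for p
  proof -
    have p: "fst p \<in> carrier G" "snd p \<in> carrier H"
      using subsetD [OF assms(1) that] by (simp_all add: DirProd_def mem_Times_iff)
    have "p [^]\<^bsub>G \<times>\<times> H\<^esub> j \<in> generate (G \<times>\<times> H) A"
      using P.subgroup_int_pow_closed [OF sub generate.incl [OF that], of "int j"]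
      by (simp add: int_pow_int)
    then show ?thesis using j [OF p] p by simp
  qed
  then have "(\<lambda>a. (a, \<one>\<^bsub>H\<^esub>)) ` fst ` A \<subseteq> generate (G \<times>\<times> H) A" by auto
  then have gen: "generate (G \<times>\<times> H) ((\<lambda>a. (a, \<one>\<^bsub>H\<^esub>)) ` fst ` A) \<subseteq> generate (G \<times>\<times> H) A"
    using P.generate_subgroup_incl [OF _ sub] by blast
  have fstA: "fst ` A \<subseteq> carrier G" using assms(1) by (auto simp: DirProd_def)
  interpret f: group_hom G "G \<times>\<times> H" "\<lambda>a. (a, \<one>\<^bsub>H\<^esub>)"
    using inl_hom by unfold_locales
  show ?thesis using f.generate_img [OF fstA] gen assms(2) by blast
qed

text \<open>Transports the result for the first factor along the coordinate swap from
  \<open>H \<times>\<times> G\<close> to \<open>G \<times>\<times> H\<close>.\<close>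

lemma snd_proj_in_generate:
  assumes "A \<subseteq> carrier (G \<times>\<times> H)" "b \<in> generate H (snd ` A)"
  shows "(\<one>\<^bsub>G\<^esub>, b) \<in> generate (G \<times>\<times> H) A"
proof -
  interpret S: coprime_groups H G by (rule swapped)
  interpret s: group_hom "H \<times>\<times> G" "G \<times>\<times> H" prod.swap
    by unfold_locales (auto simp: hom_def DirProd_def)
  have A: "prod.swap ` A \<subseteq> carrier (H \<times>\<times> G)" using assms(1) by (auto simp: DirProd_def)
  have "(b, \<one>\<^bsub>G\<^esub>) \<in> generate (H \<times>\<times> G) (prod.swap ` A)"
    using assms(2) by (intro S.fst_proj_in_generate [OF A]) (simp add: image_image)
  \<comment> \<open>The swap maps the subgroup generated by the swapped set onto the one generated
    by the twice swapped set, which is \<open>A\<close> again.\<close>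
  then have "prod.swap (b, \<one>\<^bsub>G\<^esub>) \<in> generate (G \<times>\<times> H) (prod.swap ` prod.swap ` A)"
    unfolding s.generate_img [OF A] by (rule imageI)
  then show ?thesis by (simp add: image_image)
qed

lemma generate_DirProd:
  assumes "A \<subseteq> carrier (G \<times>\<times> H)"
    and "generate G (fst ` A) = carrier G" "generate H (snd ` A) = carrier H"
  shows "generate (G \<times>\<times> H) A = carrier (G \<times>\<times> H)"
proof
  show "generate (G \<times>\<times> H) A \<subseteq> carrier (G \<times>\<times> H)" using assms(1) by (rule P.generate_incl)
  show "carrier (G \<times>\<times> H) \<subseteq> generate (G \<times>\<times> H) A"
  proof
    fix p assume "p \<in> carrier (G \<times>\<times> H)"
    then obtain a b where p: "p = (a, b)" "a \<in> carrier G" "b \<in> carrier H"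
      by (auto simp: DirProd_def)
    have "(a, \<one>\<^bsub>H\<^esub>) \<otimes>\<^bsub>G \<times>\<times> H\<^esub> (\<one>\<^bsub>G\<^esub>, b) \<in> generate (G \<times>\<times> H) A"
      using p assms by (intro generate.eng fst_proj_in_generate snd_proj_in_generate) auto
    then show "p \<in> generate (G \<times>\<times> H) A" using p by simp
  qed
qed

section \<open>Combining and projecting Beauville structures\<close>

text \<open>Each coordinate of an element common to the two \<Sigma> sets of the product is common
  to the two \<Sigma> sets of its factor, hence trivial.\<close>

lemma beauville_structure_DirProd:
  assumes G: "beauville_structure G {(x1, y1), (x2, y2)}"
    and H: "beauville_structure H {(u1, v1), (u2, v2)}"
  shows "beauville_structure (G \<times>\<times> H) {((x1, u1), (y1, v1)), ((x2, u2), (y2, v2))}"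
proof -
  note G' = G [unfolded beauville_structure_doubleton_iff]
    and H' = H [unfolded beauville_structure_doubleton_iff]
  have mem: "{(x1, u1), (y1, v1), (x2, u2), (y2, v2)} \<subseteq> carrier (G \<times>\<times> H)"
    using G' H' by simp
  have "beauville_Sigma (G \<times>\<times> H) (x1, u1) (y1, v1) \<inter> beauville_Sigma (G \<times>\<times> H) (x2, u2) (y2, v2)
      \<subseteq> {\<one>\<^bsub>G \<times>\<times> H\<^esub>}"
  proof
    fix p
    assume p: "p \<in> beauville_Sigma (G \<times>\<times> H) (x1, u1) (y1, v1) \<inter> beauville_Sigma (G \<times>\<times> H) (x2, u2) (y2, v2)"
    obtain a b where ab: "p = (a, b)" by (cases p)
    have "a \<in> beauville_Sigma G x1 y1 \<inter> beauville_Sigma G x2 y2"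
      "b \<in> beauville_Sigma H u1 v1 \<inter> beauville_Sigma H u2 v2"
      using p G' H' mem_beauville_Sigma_DirProdD unfolding ab by auto
    with G' H' ab show "p \<in> {\<one>\<^bsub>G \<times>\<times> H\<^esub>}" by simp
  qed
  moreover have "\<one>\<^bsub>G \<times>\<times> H\<^esub> \<in> beauville_Sigma (G \<times>\<times> H) (x1, u1) (y1, v1)"
    "\<one>\<^bsub>G \<times>\<times> H\<^esub> \<in> beauville_Sigma (G \<times>\<times> H) (x2, u2) (y2, v2)"
    using mem by (auto intro!: P.one_in_beauville_Sigma [OF finP] simp del: one_DirProd)
  moreover have "generate (G \<times>\<times> H) {(x1, u1), (y1, v1)} = carrier (G \<times>\<times> H)"
    "generate (G \<times>\<times> H) {(x2, u2), (y2, v2)} = carrier (G \<times>\<times> H)"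
    using mem G' H' by (intro generate_DirProd; simp)+
  ultimately show ?thesis
    unfolding beauville_structure_doubleton_iff using mem by blast
qed

lemma beauville_structure_fst:
  assumes "beauville_structure (G \<times>\<times> H) {((x1, u1), (y1, v1)), ((x2, u2), (y2, v2))}"
  shows "beauville_structure G {(x1, y1), (x2, y2)}"
proof -
  note P' = assms [unfolded beauville_structure_doubleton_iff]
  have mem: "x1 \<in> carrier G" "y1 \<in> carrier G" "u1 \<in> carrier H" "v1 \<in> carrier H"
    "x2 \<in> carrier G" "y2 \<in> carrier G" "u2 \<in> carrier H" "v2 \<in> carrier H"
    using P' by auto
  have "beauville_Sigma G x1 y1 \<inter> beauville_Sigma G x2 y2 \<subseteq> {\<one>\<^bsub>G\<^esub>}"
  proof
    fix a assume a: "a \<in> beauville_Sigma G x1 y1 \<inter> beauville_Sigma G x2 y2"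
    have "(a, \<one>\<^bsub>H\<^esub>) \<in> beauville_Sigma (G \<times>\<times> H) (x1, u1) (y1, v1) \<inter>
        beauville_Sigma (G \<times>\<times> H) (x2, u2) (y2, v2)"
      using a mem by (auto intro: mem_beauville_Sigma_DirProdI)
    then show "a \<in> {\<one>\<^bsub>G\<^esub>}" using P' by simp
  qed
  moreover have "\<one>\<^bsub>G\<^esub> \<in> beauville_Sigma G x1 y1" "\<one>\<^bsub>G\<^esub> \<in> beauville_Sigma G x2 y2"
    using mem by (auto intro: G.one_in_beauville_Sigma [OF finG])
  moreover have "generate G {x1, y1} = carrier G" "generate G {x2, y2} = carrier G"
    using P' fst_generate [of "{(x1, u1), (y1, v1)}"] fst_generate [of "{(x2, u2), (y2, v2)}"]
    by auto
  ultimately show ?thesis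
    unfolding beauville_structure_doubleton_iff using mem by blast
qed

section \<open>Automorphisms and strong reality\<close>

text \<open>The components of \<open>\<phi>\<close> from \<open>G\<close> to \<open>H\<close> and
  from \<open>H\<close> to \<open>G\<close> are trivial homomorphisms, so the first coordinate of
  \<open>\<phi> (a, b)\<close> does not depend on \<open>b\<close>.\<close>

lemma fst_auto:
  assumes "\<phi> \<in> auto (G \<times>\<times> H)"
  obtains \<psi> where "\<psi> \<in> auto G"
    "\<And>a b. a \<in> carrier G \<Longrightarrow> b \<in> carrier H \<Longrightarrow> fst (\<phi> (a, b)) = \<psi> a"
proof
  \<comment> \<open>The restriction to \<open>carrier G\<close> is there because members of
    \<open>auto\<close> must be extensional.\<close>
  let ?\<psi> = "\<lambda>a\<in>carrier G. fst (\<phi> (a, \<one>\<^bsub>H\<^esub>))"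
  interpret S: coprime_groups H G by (rule swapped)
  have \<phi>: "\<phi> \<in> hom (G \<times>\<times> H) (G \<times>\<times> H)" and inj: "inj_on \<phi> (carrier (G \<times>\<times> H))"
    using assms by (auto simp: auto_def Bij_def bij_betw_def)
  interpret f: group_hom "G \<times>\<times> H" "G \<times>\<times> H" \<phi>
    using \<phi> by unfold_locales
  have \<psi>: "fst \<circ> \<phi> \<circ> (\<lambda>a. (a, \<one>\<^bsub>H\<^esub>)) \<in> hom G G"
    by (intro hom_compose [OF inl_hom] hom_compose [OF \<phi> fst_hom])
  have "snd \<circ> \<phi> \<circ> (\<lambda>a. (a, \<one>\<^bsub>H\<^esub>)) \<in> hom G H"
    by (intro hom_compose [OF inl_hom] hom_compose [OF \<phi> snd_hom])
  from hom_eq_one [OF this]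
  have 1: "snd (\<phi> (a, \<one>\<^bsub>H\<^esub>)) = \<one>\<^bsub>H\<^esub>" if "a \<in> carrier G" for a
    using that by simp
  have "fst \<circ> \<phi> \<circ> (\<lambda>b. (\<one>\<^bsub>G\<^esub>, b)) \<in> hom H G"
    by (intro hom_compose [OF inr_hom] hom_compose [OF \<phi> fst_hom])
  from S.hom_eq_one [OF this]
  have 2: "fst (\<phi> (\<one>\<^bsub>G\<^esub>, b)) = \<one>\<^bsub>G\<^esub>" if "b \<in> carrier H" for b
    using that by simp
  have "inj_on ?\<psi> (carrier G)"
  proof (rule inj_onI)
    fix a a' assume a: "a \<in> carrier G" "a' \<in> carrier G" "?\<psi> a = ?\<psi> a'"
    then have "\<phi> (a, \<one>\<^bsub>H\<^esub>) = \<phi> (a', \<one>\<^bsub>H\<^esub>)" using 1 by (simp add: prod_eq_iff)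
    with a inj show "a = a'" by (simp add: inj_on_eq_iff)
  qed
  moreover have "?\<psi> ` carrier G \<subseteq> carrier G"
    using \<psi> by (auto simp: hom_def)
  ultimately have "bij_betw ?\<psi> (carrier G) (carrier G)"
    using endo_inj_surj [OF finG] by (simp add: bij_betw_def)
  moreover have "?\<psi> \<in> hom G G" using \<psi> by (auto simp: hom_def)
  ultimately show "?\<psi> \<in> auto G" by (simp add: auto_def Bij_def)
  show "fst (\<phi> (a, b)) = ?\<psi> a" if ab: "a \<in> carrier G" "b \<in> carrier H" for a b
  proof -
    have "fst (\<phi> (a, b)) = fst (\<phi> ((a, \<one>\<^bsub>H\<^esub>) \<otimes>\<^bsub>G \<times>\<times> H\<^esub> (\<one>\<^bsub>G\<^esub>, b)))" using ab by simp
    also have "\<dots> = fst (\<phi> (a, \<one>\<^bsub>H\<^esub>) \<otimes>\<^bsub>G \<times>\<times> H\<^esub> \<phi> (\<one>\<^bsub>G\<^esub>, b))"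
      using ab by (subst f.hom_mult) auto
    also have "\<dots> = fst (\<phi> (a, \<one>\<^bsub>H\<^esub>)) \<otimes>\<^bsub>G\<^esub> fst (\<phi> (\<one>\<^bsub>G\<^esub>, b))"
      using ab by (intro hom_mult [OF fst_hom] f.hom_closed) auto
    also have "\<dots> = ?\<psi> a" using ab 2 hom_in_carrier [OF \<psi>] by simp
    finally show ?thesis .
  qed
qed

text \<open>Conjugation and inversion act coordinatewise, so the first coordinates of the
  conjugating elements, together with the automorphism induced on \<open>G\<close>, invert the
  projected generators.\<close>

lemma strongly_real_fst:
  assumes S: "beauville_structure (G \<times>\<times> H) S" and real: "strongly_real (G \<times>\<times> H) S"
  shows "\<exists>T. beauville_structure G T \<and> strongly_real G T"
proof -
  from real obtain p1 q1 p2 q2 \<phi> k1 k2 where Seq: "S = {(p1, q1), (p2, q2)}"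
    and \<phi>: "\<phi> \<in> auto (G \<times>\<times> H)"
    and k: "k1 \<in> carrier (G \<times>\<times> H)" "k2 \<in> carrier (G \<times>\<times> H)"
    and eqs: "k1 \<otimes>\<^bsub>G \<times>\<times> H\<^esub> \<phi> p1 \<otimes>\<^bsub>G \<times>\<times> H\<^esub> inv\<^bsub>G \<times>\<times> H\<^esub> k1 = inv\<^bsub>G \<times>\<times> H\<^esub> p1"
      "k1 \<otimes>\<^bsub>G \<times>\<times> H\<^esub> \<phi> q1 \<otimes>\<^bsub>G \<times>\<times> H\<^esub> inv\<^bsub>G \<times>\<times> H\<^esub> k1 = inv\<^bsub>G \<times>\<times> H\<^esub> q1"
      "k2 \<otimes>\<^bsub>G \<times>\<times> H\<^esub> \<phi> p2 \<otimes>\<^bsub>G \<times>\<times> H\<^esub> inv\<^bsub>G \<times>\<times> H\<^esub> k2 = inv\<^bsub>G \<times>\<times> H\<^esub> p2"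
      "k2 \<otimes>\<^bsub>G \<times>\<times> H\<^esub> \<phi> q2 \<otimes>\<^bsub>G \<times>\<times> H\<^esub> inv\<^bsub>G \<times>\<times> H\<^esub> k2 = inv\<^bsub>G \<times>\<times> H\<^esub> q2"
    unfolding strongly_real_def by blast
  \<comment> \<open>The doubleton for \<open>S\<close> supplied by \<open>strongly_real\<close> may
    list the pairs in another order than the one from \<open>beauville_structure\<close>; the
    doubleton criterion holds for either.\<close>
  have mem: "p1 \<in> carrier (G \<times>\<times> H)" "q1 \<in> carrier (G \<times>\<times> H)"
    "p2 \<in> carrier (G \<times>\<times> H)" "q2 \<in> carrier (G \<times>\<times> H)"
    using S unfolding Seq beauville_structure_doubleton_iff by simp_all
  obtain \<psi> where \<psi>: "\<psi> \<in> auto G"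
    "\<And>a b. a \<in> carrier G \<Longrightarrow> b \<in> carrier H \<Longrightarrow> fst (\<phi> (a, b)) = \<psi> a"
    using fst_auto [OF \<phi>] by blast
  have proj: "fst k \<otimes>\<^bsub>G\<^esub> \<psi> (fst p) \<otimes>\<^bsub>G\<^esub> inv\<^bsub>G\<^esub> fst k = inv\<^bsub>G\<^esub> fst p"
    if "k \<in> carrier (G \<times>\<times> H)" "p \<in> carrier (G \<times>\<times> H)"
      and e: "k \<otimes>\<^bsub>G \<times>\<times> H\<^esub> \<phi> p \<otimes>\<^bsub>G \<times>\<times> H\<^esub> inv\<^bsub>G \<times>\<times> H\<^esub> k = inv\<^bsub>G \<times>\<times> H\<^esub> p" for k p
  proof -
    obtain g h x u where [simp]: "k = (g, h)" "p = (x, u)" by (metis surj_pair)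
    have c: "g \<in> carrier G" "h \<in> carrier H" "x \<in> carrier G" "u \<in> carrier H" using that by auto
    obtain c d where cd: "\<phi> p = (c, d)" by (metis surj_pair)
    have "c = \<psi> x" using \<psi>(2) [OF c(3,4)] cd by simp
    then show ?thesis using e c cd by (simp add: G.is_group H.is_group)
  qed
  have "beauville_structure G {(fst p1, fst q1), (fst p2, fst q2)}"
    using beauville_structure_fst [of "fst p1" "snd p1" "fst q1" "snd q1"
        "fst p2" "snd p2" "fst q2" "snd q2"] S
    unfolding Seq by simp
  moreover have "fst k1 \<in> carrier G" "fst k2 \<in> carrier G" using k by (auto simp: DirProd_def)
  then have "strongly_real G {(fst p1, fst q1), (fst p2, fst q2)}"
    unfolding strongly_real_def using \<psi>(1) proj k mem eqs by blast
  ultimately show ?thesis by blast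
qed

end

theorem proposition4p1:
  fixes G :: "('a, 'm) monoid_scheme" and H :: "('b, 'n) monoid_scheme"
  assumes "beauville_group G" and "beauville_group H"
    and "coprime (order G) (order H)"
    and "purely_non_strongly_real G"
  shows "purely_non_strongly_real (G \<times>\<times> H)"
proof -
  interpret coprime_groups G H
    using assms(1-3) by (auto simp: beauville_group_def coprime_groups_def coprime_groups_axioms_def)
  obtain x1 y1 x2 y2 where "beauville_structure G {(x1, y1), (x2, y2)}"
    using assms(1) unfolding beauville_group_def by (metis beauville_structure_def)
  moreover obtain u1 v1 u2 v2 where "beauville_structure H {(u1, v1), (u2, v2)}"
    using assms(2) unfolding beauville_group_def by (metis beauville_structure_def)
  ultimately have "beauville_group (G \<times>\<times> H)"
    unfolding beauville_group_def using P.is_group finP beauville_structure_DirProd by blast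
  then show ?thesis
    using assms(4) strongly_real_fst unfolding purely_non_strongly_real_def by blast
qed

end
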